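(* Assume the ABC-conjecture. Let $f(x)\in\mathbb{Q}[x]$ be a polynomial of degree $d\geq 2$ which is not a monomial and which has at least two distinct (complex) roots. Fix a non-zero integer $b$, an integer $r\geq1$ and positive integers $A_1,\dots,A_r$. Then the equation $$b\, n_1!A_1^{n_1}\cdots n_r!A_r^{n_r}=f(x)$$ has only finitely many integer solutions $(n_1,\dots,n_r,x)$ with all $n_i>0$.
   Context: For a non-zero integer $a$, the radical is $N(a)=\prod_{p\mid a}p$ (product over the distinct primes dividing $a$). The ABC-conjecture is the statement: for every $\epsilon>0$ there is a constant $K(\epsilon)$ depending only on $\epsilon$ such that whenever $A,B,C$ are pairwise coprime non-zero integers with $A+B=C$, one has $\max\{|A|,|B|,|C|\}<K(\epsilon)N(ABC)^{1+\epsilon}$. *)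

theory Defs
  imports
    Complex_Main
    "HOL-Computational_Algebra.Computational_Algebra"
    "HOL-Library.FuncSet"
begin

text \<open>On \<^typ>\<open>int\<close>, \<^const>\<open>prime_factors\<close> yields the distinct positive primes dividing a
  non-zero argument, so this radical is positive, also for negative \<open>a\<close>.\<close>

definition int_radical :: "int \<Rightarrow> int" where
  "int_radical a = (\<Prod>p\<in>prime_factors a. p)"

definition abc_conjecture :: bool where
  "abc_conjecture \<longleftrightarrow>
     (\<forall>\<epsilon>::real. \<epsilon> > 0 \<longrightarrow>
       (\<exists>K::real. \<forall>A B C :: int.
          A \<noteq> 0 \<longrightarrow> B \<noteq> 0 \<longrightarrow> C \<noteq> 0 \<longrightarrow>
          coprime A B \<longrightarrow> coprime A C \<longrightarrow> coprime B C \<longrightarrow>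
          A + B = C \<longrightarrow>
          real_of_int (Max {\<bar>A\<bar>, \<bar>B\<bar>, \<bar>C\<bar>})
            < K * real_of_int (int_radical (A * B * C)) powr (1 + \<epsilon>)))"

end

theory Submission
  imports Defs
begin

text \<open>Completing the \<open>d\<close>-th power and clearing denominators turns the equation into
  \<open>h(y) = e b n\<^sub>1! A\<^sub>1^n\<^sub>1 \<dots> n\<^sub>r! A\<^sub>r^n\<^sub>r\<close> with \<open>y = m x + u\<close> and
  \<open>h(y) = y^j (a y^k + S(y))\<close>, where \<open>S(0) \<noteq> 0\<close> and \<open>deg S \<le> k - 2\<close>; here \<open>S \<noteq> 0\<close> because \<open>f\<close> has two
  distinct roots. The gcd of \<open>a y^k\<close> and \<open>S(y)\<close> divides \<open>a S(0)^k\<close>, so the abc conjecture applied to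
  \<open>a y^k + S(y)\<close> bounds \<open>\<bar>y\<bar>^k\<close> by roughly \<open>(\<bar>y\<bar>^(k - 1) rad(h(y)))^(1 + \<epsilon>)\<close>, whence \<open>\<bar>y\<bar>\<close> is at most
  a constant times \<open>rad(h(y))^4\<close>. With \<open>t = max n\<^sub>i\<close>, that radical is \<open>O(4^t)\<close> by Chebyshev's bound on
  the product of the primes up to \<open>t\<close>, while \<open>t! \<le> \<bar>h(y)\<bar>\<close>, which is \<open>O(max(1, \<bar>y\<bar>)^d)\<close>. So \<open>t!\<close> grows at
  most exponentially in \<open>t\<close>, and \<open>t\<close> is bounded.\<close>

section \<open>Products of distinct primes and Chebyshev's primorial bound\<close>

lemma prod_primes_dvd:
  fixes n :: "'a :: factorial_semiring_gcd"
  assumes "finite S" and "\<And>p. p \<in> S \<Longrightarrow> prime p" and "\<And>p. p \<in> S \<Longrightarrow> p dvd n"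
  shows "\<Prod>S dvd n"
  using assms
proof (induction S rule: finite_induct)
  case (insert p S)
  have "coprime p (\<Prod>S)"
    by (intro prod_coprime_right primes_coprime) (use insert in auto)
  with insert show ?case
    by (auto intro: divides_mult)
qed simp

text \<open>Erdos's induction. An even n > 2 is not prime, so n - 1 has the same primorial. For n =
  2m + 1 the primes in (m + 1, n] divide n! but neither m! nor (m + 1)!, hence they divide
  \<open>n choose m\<close>, which is at most 4^m; the induction hypothesis at m + 1 supplies the
  other factor.\<close>

lemma primorial_le:
  "(\<Prod>p | prime p \<and> p \<le> n. p) \<le> 4 ^ n" for n :: nat
proof (induction n rule: less_induct)
  case (less n)
  let ?P = "\<lambda>n. {p :: nat. prime p \<and> p \<le> n}"
  consider "n \<le> 1" | "n = 2" | "even n" "n > 2" | "odd n" "n > 1"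
    by linarith
  then show ?case
  proof cases
    case 1
    then have "?P n = {}"
      by (auto dest: prime_gt_1_nat)
    then show ?thesis by (simp only:) simp
  next
    case 2
    then have "?P n = {2}"
      by (auto dest: prime_ge_2_nat intro: antisym)
    then show ?thesis using 2 by (simp only:) simp
  next
    case 3
    then have "\<not> prime n"
      using prime_odd_nat by blast
    then have "p \<le> n \<longleftrightarrow> p \<le> n - 1" if "prime p" for p
      using that by (cases "p = n") auto
    then have "?P n = ?P (n - 1)"
      by blast
    then have "\<Prod>(?P n) \<le> 4 ^ (n - 1)"
      using less[of "n - 1"] 3 by simp
    also have "\<dots> \<le> 4 ^ n"
      by (rule power_increasing) auto
    finally show ?thesis .
  next
    case 4
    then obtain m where n: "n = 2 * m + 1"
      by (auto elim: oddE)
    with 4 have "m > 0" by auto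
    let ?Q = "{p :: nat. prime p \<and> m + 1 < p \<and> p \<le> n}"
    have "\<Prod>?Q dvd n choose m"
    proof (rule prod_primes_dvd)
      fix p assume p: "p \<in> ?Q"
      then have "p dvd fact n"
        by (simp add: prime_dvd_fact_iff)
      also have "fact n = fact m * fact (m + 1) * (n choose m)"
        using binomial_fact_lemma[of m n] by (simp add: n)
      finally show "p dvd n choose m"
        using p by (auto simp: prime_dvd_mult_iff prime_dvd_fact_iff simp del: fact_Suc)
    qed auto
    then have "\<Prod>?Q \<le> n choose m"
      by (rule dvd_imp_le) (simp add: n)
    \<comment> \<open>By symmetry the entries with k \<le> m carry half of the total 2^(2m + 1) of
      row 2m + 1 of Pascal's triangle.\<close>
    also have "\<dots> \<le> (\<Sum>k\<le>m. n choose k)"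
      by (rule member_le_sum) auto
    also have "\<dots> = 4 ^ m"
      using binomial_r_part_sum[of m] by (simp add: n power_mult)
    finally have Q: "\<Prod>?Q \<le> 4 ^ m" .
    have "?P n = ?P (m + 1) \<union> ?Q"
      using n by auto
    then have "\<Prod>(?P n) = \<Prod>(?P (m + 1)) * \<Prod>?Q"
      by (simp only:) (rule prod.union_disjoint, auto)
    also have "\<dots> \<le> 4 ^ (m + 1) * 4 ^ m"
      using less[of "m + 1"] n \<open>m > 0\<close> Q by (intro mult_mono) auto
    also have "\<dots> = 4 ^ n"
      by (simp add: n flip: power_add)
    finally show ?thesis .
  qed
qed

section \<open>Radicals of integers\<close>

lemma int_radical_pos: "int_radical a > 0"
  unfolding int_radical_def by (rule prod_pos) (auto simp: in_prime_factors_iff dest: prime_gt_0_int)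

lemma int_radical_le: "a \<noteq> 0 \<Longrightarrow> int_radical a \<le> \<bar>a\<bar>"
  unfolding int_radical_def
  by (rule zdvd_imp_le) (auto intro!: prod_primes_dvd simp: in_prime_factors_iff)

lemma int_radical_dvd_mono: "b \<noteq> 0 \<Longrightarrow> a dvd b \<Longrightarrow> int_radical a \<le> int_radical b"
  unfolding int_radical_def
  by (rule prod_mono2)
    (auto simp: in_prime_factors_iff dest: prime_gt_0_int intro: dvd_trans)

lemma prod_Un_le_int:
  fixes S T :: "int set"
  assumes "finite S" "finite T" "\<And>x. x \<in> S \<union> T \<Longrightarrow> x > 0"
  shows "\<Prod>(S \<union> T) \<le> \<Prod>S * \<Prod>T"
proof -
  have "\<Prod>(S \<union> T) = \<Prod>S * \<Prod>(T - S)"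
    using assms prod.union_disjoint[of S "T - S" "\<lambda>x. x"] by simp
  also have "\<dots> \<le> \<Prod>S * \<Prod>T"
  proof (rule mult_left_mono)
    show "\<Prod>(T - S) \<le> \<Prod>T"
      using assms by (intro prod_mono2) (auto simp: int_one_le_iff_zero_less intro: less_imp_le)
    show "\<Prod>S \<ge> 0"
      using assms by (intro prod_nonneg) (auto simp: less_imp_le)
  qed
  finally show ?thesis .
qed

lemma int_radical_mult_le:
  assumes "a \<noteq> 0" "b \<noteq> 0"
  shows "int_radical (a * b) \<le> int_radical a * int_radical b"
  unfolding int_radical_def prime_factors_product[OF assms]
  by (rule prod_Un_le_int) (auto simp: in_prime_factors_iff dest: prime_gt_0_int)

text \<open>Exponents do not affect the radical: a prime factor divides \<open>c\<close>, some
  \<open>A i\<close>, or some factorial, and in the last case it is at most \<open>M\<close>. The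
  first two kinds contribute a factor independent of \<open>n\<close>, the third at most the
  primorial of \<open>M\<close>.\<close>

lemma int_radical_factorials_le:
  fixes c :: int and n A :: "nat \<Rightarrow> nat"
  assumes "finite I" "c \<noteq> 0" "\<And>i. i \<in> I \<Longrightarrow> A i > 0" "\<And>i. i \<in> I \<Longrightarrow> n i \<le> M"
  shows "int_radical (c * (\<Prod>i\<in>I. fact (n i) * int (A i) ^ n i))
           \<le> \<bar>c * (\<Prod>i\<in>I. int (A i))\<bar> * 4 ^ M"
proof -
  let ?a = "c * (\<Prod>i\<in>I. fact (n i) * int (A i) ^ n i)"
  let ?b = "c * (\<Prod>i\<in>I. int (A i))"
  let ?P = "{p :: nat. prime p \<and> p \<le> M}"
  have nz: "?b \<noteq> 0"
    using assms by fastforce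
  have sub: "p \<in> prime_factors ?b \<union> int ` ?P" if "p \<in> prime_factors ?a" for p
  proof -
    have p: "prime p" "p dvd ?a"
      using that by (auto simp: in_prime_factors_iff)
    show ?thesis
    proof (cases "p dvd ?b")
      case True
      with p nz show ?thesis by (simp add: in_prime_factors_iff)
    next
      case False
      with p assms obtain i where i: "i \<in> I" "p dvd fact (n i) * int (A i) ^ n i"
        by (auto simp: prime_dvd_mult_iff prime_dvd_prod_iff)
      with p False assms have "p dvd fact (n i)"
        by (auto simp: prime_dvd_mult_iff prime_dvd_prod_iff dest: prime_dvd_power)
      moreover obtain q where q: "p = int q" "prime q"
        using p(1) by (metis prime_ge_0_int prime_int_nat_transfer zero_le_imp_eq_int int_nat_eq)
      ultimately have "q dvd fact (n i)"
        by (metis of_nat_dvd_iff of_nat_fact)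
      with q i(1) assms(4) show ?thesis
        by (auto simp: prime_dvd_fact_iff intro: order_trans)
    qed
  qed
  have pos: "p > 0" if "p \<in> prime_factors ?b \<union> int ` ?P" for p
    using that by (auto simp: in_prime_factors_iff dest: prime_gt_0_int prime_gt_0_nat)
  have "int_radical ?a \<le> \<Prod>(prime_factors ?b \<union> int ` ?P)"
    unfolding int_radical_def
  proof (rule prod_mono2)
    show "prime_factors ?a \<subseteq> prime_factors ?b \<union> int ` ?P"
      using sub by (rule subsetI)
    show "1 \<le> p" if "p \<in> (prime_factors ?b \<union> int ` ?P) - prime_factors ?a" for p
      using pos[OF DiffD1[OF that]] by simp
    show "0 \<le> p" if "p \<in> prime_factors ?a" for p
      using pos[OF sub[OF that]] by simp
  qed simp
  also have "\<dots> \<le> \<Prod>(prime_factors ?b) * \<Prod>(int ` ?P)"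
    by (rule prod_Un_le_int) (use pos in simp_all)
  also have "\<Prod>(int ` ?P) = int (\<Prod>?P)"
    by (subst prod.reindex) (auto simp: inj_on_def)
  also have "\<Prod>(prime_factors ?b) * int (\<Prod>?P) \<le> \<bar>?b\<bar> * 4 ^ M"
  proof (rule mult_mono)
    show "\<Prod>(prime_factors ?b) \<le> \<bar>?b\<bar>"
      using int_radical_le[OF nz] by (simp add: int_radical_def)
    show "int (\<Prod>?P) \<le> 4 ^ M"
      using primorial_le[of M] by (metis of_nat_le_iff of_nat_numeral of_nat_power)
  qed (auto intro!: prod_nonneg)
  finally show ?thesis .
qed

section \<open>Factorials against exponentials\<close>

text \<open>The terms X^n / n! of the exponential series tend to 0, so C X^n / n! is eventually
  below 1.\<close>

lemma fact_le_power_imp_bounded: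
  fixes C X :: real
  obtains M where "\<And>n. fact n \<le> C * X ^ n \<Longrightarrow> n < M"
proof -
  have "(\<lambda>n. inverse (fact n) * X ^ n) \<longlonglongrightarrow> 0"
    by (rule summable_LIMSEQ_zero[OF summable_exp])
  then have "(\<lambda>n. C * (inverse (fact n) * X ^ n)) \<longlonglongrightarrow> C * 0"
    by (intro tendsto_intros)
  then have "\<forall>\<^sub>F n in sequentially. C * (inverse (fact n) * X ^ n) < 1"
    by (rule order_tendstoD) simp
  then obtain M where M: "\<And>n. n \<ge> M \<Longrightarrow> C * (inverse (fact n) * X ^ n) < 1"
    by (auto simp: eventually_sequentially)
  show thesis
  proof (rule that[of M], rule ccontr)
    fix n assume "fact n \<le> C * X ^ n" "\<not> n < M"
    with M[of n] show False
      by (simp add: field_simps not_less) 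
  qed
qed

section \<open>Reduction to an integer polynomial without second-highest term\<close>

text \<open>Under the degree bound only the terms of \<open>p\<close> of degree n and n + 1 reach
  this coefficient. The formula shows which shift \<open>c\<close> makes the second-highest
  coefficient vanish.\<close>

lemma coeff_pcompose_linear:
  fixes p :: "'a :: comm_ring_1 poly"
  assumes "degree p \<le> Suc n"
  shows "coeff (p \<circ>\<^sub>p [:c, a:]) n = a ^ n * (coeff p n + of_nat (Suc n) * c * coeff p (Suc n))"
  using assms
proof (induction p arbitrary: n)
  case (pCons b p)
  show ?case
  proof (cases n)
    case 0
    with pCons.prems have "degree p = 0"
      by (auto split: if_splits)
    then obtain q where "p = [:q:]"
      by (rule degree_eq_zeroE)
    then show ?thesis by (simp add: 0 pcompose_pCons)
  next
    case (Suc m)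
    with pCons.prems have deg: "degree p \<le> Suc m"
      by (auto split: if_splits)
    then have "coeff p (Suc (Suc m)) = 0"
      by (intro coeff_eq_0) auto
    with pCons.IH[of m] pCons.IH[of "Suc m"] deg Suc show ?thesis
      by (simp add: pcompose_pCons algebra_simps)
  qed
qed simp

lemma rat_poly_clear_denominators:
  fixes g :: "rat poly"
  obtains e :: int and h :: "int poly"
  where "e > 0" and "smult (of_int e) g = map_poly of_int h"
proof -
  have "\<exists>(e :: int) h. e > 0 \<and> smult (of_int e) g = map_poly of_int h"
  proof (induction g)
    case 0
    then show ?case by (intro exI[of _ 1] exI[of _ 0]) auto
  next
    case (pCons c g)
    then obtain e :: int and h where eh: "e > 0" "smult (of_int e) g = map_poly of_int h"
      by blast
    obtain p q where pq: "quotient_of c = (p, q)"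
      by force
    then have q: "q > 0" and c: "c = of_int p / of_int q"
      by (auto intro: quotient_of_denom_pos quotient_of_div)
    have "smult (of_int (q * e)) (pCons c g) = pCons (of_int (p * e)) (smult (of_int q) (smult (of_int e) g))"
      using q c by (simp add: mult.commute)
    also have "\<dots> = map_poly of_int (pCons (p * e) (smult q h))"
      unfolding eh(2) by (intro poly_eqI) (auto simp: coeff_map_poly coeff_pCons split: nat.splits)
    finally show ?case
      using q eh(1) by (metis mult_pos_pos)
  qed
  with that show thesis by blast
qed

lemma poly_map_poly_of_int: "poly (map_poly of_int h) (of_int y) = of_int (poly h y)"
  by (induction h) (simp_all add: map_poly_pCons)

lemma pcompose_monom: "monom a n \<circ>\<^sub>p q = smult a (q ^ n)"
  by (induction n) (simp_all add: monom_0 monom_Suc pcompose_pCons)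

text \<open>Over the complex numbers \<open>f\<close> is still a multiple of a power of one linear
  form, hence has a single root. Two distinct roots therefore exclude this shape.\<close>

lemma complex_roots_linear_power:
  assumes "f = smult c ([:u, m:] ^ d)" "c \<noteq> 0" "m \<noteq> 0"
    and "poly (map_poly of_rat f) z = (0 :: complex)"
  shows "z = - of_rat u / of_rat m"
proof -
  have "map_poly of_rat f = smult (of_rat c) ([:of_rat u, of_rat m :: complex:] ^ d)"
  proof (rule poly_eqI)
    fix i
    \<comment> \<open>The binomial formula for the coefficients covers only i \<le> d; beyond that
      both sides vanish by degree.\<close>
    have "coeff ([:u, m:] ^ d) i = 0" "coeff ([:of_rat u, of_rat m :: complex:] ^ d) i = 0" if "i > d"
      using that by (auto intro!: coeff_eq_0 le_less_trans[OF degree_power_le])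
    then show "coeff (map_poly of_rat f) i =
        coeff (smult (of_rat c) ([:of_rat u, of_rat m :: complex:] ^ d)) i"
      by (cases "i \<le> d")
        (simp_all add: assms(1) coeff_map_poly coeff_linear_poly_power of_rat_mult of_rat_power)
  qed
  with assms(4) have "(of_rat u + z * of_rat m) ^ d = 0"
    using assms(2) by (simp add: poly_power)
  then have "z * of_rat m = - of_rat u"
    by (simp add: eq_neg_iff_add_eq_0 add.commute)
  with assms(3) show ?thesis
    by (simp add: field_simps)
qed

lemma depressed_integer_form:
  fixes f :: "rat poly"
  assumes d: "degree f \<ge> 1"
    and roots: "poly (map_poly of_rat f) z = (0 :: complex)"
      "poly (map_poly of_rat f) w = 0" "z \<noteq> w"
  obtains e m u :: int and h :: "int poly"
  where "e \<noteq> 0" and "degree h = degree f" and "coeff h (degree f - 1) = 0"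
    and "\<And>c k. h \<noteq> monom c k"
    and "\<And>x. of_int e * poly f (of_int x) = of_int (poly h (m * x + u))"
proof -
  \<comment> \<open>\<open>- s\<close> is the mean of the complex roots of \<open>f\<close>, counted
    with multiplicity; centring there removes the coefficient below the leading one.\<close>
  define s where "s = coeff f (degree f - 1) / (of_nat (degree f) * lead_coeff f)"
  obtain u m where "quotient_of s = (u, m)"
    by force
  then have m: "m > 0" and s: "s = of_int u / of_int m"
    by (auto intro: quotient_of_denom_pos quotient_of_div)
  \<comment> \<open>Scaling by the denominator of \<open>s\<close> turns x = y/m - s into y = m x +
    u, so integers x correspond to integers y.\<close>
  define g where "g = f \<circ>\<^sub>p [:- s, 1 / of_int m:]"
  obtain e h where e: "e > 0" and h: "smult (of_int e) g = map_poly of_int h"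
    by (rule rat_poly_clear_denominators)
  have coeff_h: "rat_of_int (coeff h i) = of_int e * coeff g i" for i
    using arg_cong[OF h, of "\<lambda>p. coeff p i"] by (simp add: coeff_map_poly)
  have deg_g: "degree g = degree f"
    using m by (simp add: g_def degree_pcompose)
  have "degree (map_poly rat_of_int h) = degree h"
    by (rule degree_map_poly) simp
  with h deg_g e have deg_h: "degree h = degree f"
    by (metis degree_smult_eq less_irrefl of_int_eq_0_iff)
  have f: "f = g \<circ>\<^sub>p [:of_int u, of_int m:]"
    using m by (simp add: g_def s pcompose_pCons flip: pcompose_assoc)
  have "coeff g (degree f - 1) = 0"
    using d m
    by (auto simp: g_def coeff_pcompose_linear s_def Suc_diff_1 simp del: of_nat_Suc)
  then have "coeff h (degree f - 1) = 0"
    using coeff_h by (metis mult_zero_right of_int_eq_0_iff)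
  \<comment> \<open>Undoing the substitution, a monomial \<open>h\<close> would make
    \<open>f\<close> a multiple of a power of m x + u, with only one root.\<close>
  moreover have "h \<noteq> monom c k" for c k
  proof
    assume hm: "h = monom c k"
    have "c \<noteq> 0"
      using hm d deg_h by auto
    have "g = monom (of_int c / of_int e) k"
    proof (rule poly_eqI)
      fix i
      show "coeff g i = coeff (monom (of_int c / of_int e) k) i"
        using coeff_h[of i] hm e by (auto simp: field_simps)
    qed
    then have "f = smult (of_int c / of_int e) ([:of_int u, of_int m:] ^ k)"
      using f by (simp add: pcompose_monom)
    from complex_roots_linear_power[OF this] have "x = - of_rat (of_int u) / of_rat (of_int m)"
      if "poly (map_poly of_rat f) x = 0" for x :: complex
      using that \<open>c \<noteq> 0\<close> e m by simp
    with roots show False by metis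
  qed
  moreover have "of_int e * poly f (of_int x) = of_int (poly h (m * x + u))" for x
  proof -
    have "of_int e * poly f (of_int x) = poly (smult (of_int e) g) (of_int (m * x + u))"
      by (subst f) (simp add: poly_pcompose algebra_simps)
    then show ?thesis
      by (simp only: h poly_map_poly_of_int)
  qed
  ultimately show thesis
    using that[of e h m u] e deg_h by auto
qed

section \<open>The abc conjecture applied to polynomial values\<close>

lemma abs_poly_le:
  fixes p :: "int poly"
  assumes "degree p \<le> n"
  shows "\<bar>poly p y\<bar> \<le> (\<Sum>i\<le>n. \<bar>coeff p i\<bar>) * max 1 \<bar>y\<bar> ^ n"
proof -
  have "\<bar>poly p y\<bar> = \<bar>\<Sum>i\<le>n. coeff p i * y ^ i\<bar>"
    unfolding poly_altdef using assms
    by (intro arg_cong[where f = abs] sum.mono_neutral_left) (auto simp: coeff_eq_0)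
  also have "\<dots> \<le> (\<Sum>i\<le>n. \<bar>coeff p i\<bar> * \<bar>y\<bar> ^ i)"
    by (rule order_trans[OF sum_abs]) (simp add: abs_mult power_abs)
  also have "\<dots> \<le> (\<Sum>i\<le>n. \<bar>coeff p i\<bar> * max 1 \<bar>y\<bar> ^ n)"
  proof (intro sum_mono mult_left_mono)
    fix i assume "i \<in> {..n}"
    then have "\<bar>y\<bar> ^ i \<le> max 1 \<bar>y\<bar> ^ i" "max 1 \<bar>y\<bar> ^ i \<le> max 1 \<bar>y\<bar> ^ n"
      by (auto intro: power_mono power_increasing)
    then show "\<bar>y\<bar> ^ i \<le> max 1 \<bar>y\<bar> ^ n" by simp
  qed auto
  finally show ?thesis
    by (simp add: sum_distrib_right)
qed

lemma int_radical_power_le: "int_radical (y ^ k) \<le> int_radical y"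
  unfolding int_radical_def
proof (rule prod_mono2)
  show "prime_factors (y ^ k) \<subseteq> prime_factors y"
    by (cases "k = 0") (auto simp: in_prime_factors_iff dest: prime_dvd_power)
qed (auto simp: in_prime_factors_iff int_one_le_iff_zero_less
    dest: prime_gt_0_int intro: prime_ge_0_int)

text \<open>Since p(y) is congruent to p(0) modulo y, common divisors of y and p(y) divide p(0);
  replacing y by y^k costs a k-th power, and the factor \<open>a\<close> costs one more
  \<open>a\<close>. The resulting bound is independent of y.\<close>

lemma gcd_mult_power_poly_dvd:
  fixes p :: "int poly"
  shows "gcd (a * y ^ k) (poly p y) dvd a * poly p 0 ^ k"
proof -
  have "y dvd poly p y - poly p 0"
    by (induction p) (auto simp: algebra_simps)
  then have "gcd y (poly p y) dvd poly p y - (poly p y - poly p 0)"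
    by (rule dvd_diff[OF gcd_dvd2 dvd_trans[OF gcd_dvd1]])
  then have "gcd y (poly p y) dvd poly p 0" by simp
  moreover have "gcd (y ^ k) (poly p y) dvd gcd y (poly p y) ^ k"
  proof (cases "k = 0")
    case False
    then have "poly p y dvd poly p y ^ k" by simp
    then have "gcd (y ^ k) (poly p y) dvd gcd (y ^ k) (poly p y ^ k)"
      by (meson dvd_trans gcd_dvd1 gcd_dvd2 gcd_greatest)
    then show ?thesis by simp
  qed simp
  ultimately have "gcd (y ^ k) (poly p y) dvd poly p 0 ^ k"
    by (meson dvd_power_same dvd_trans)
  moreover have "gcd (a * y ^ k) (poly p y) dvd gcd (a * y ^ k) (a * poly p y)"
    by (meson dvd_mult dvd_trans gcd_dvd1 gcd_dvd2 gcd_greatest)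
  then have "gcd (a * y ^ k) (poly p y) dvd a * gcd (y ^ k) (poly p y)"
    by (simp only: gcd_mult_left dvd_normalize_iff)
  ultimately show ?thesis
    by (meson dvd_trans mult_dvd_mono dvd_refl)
qed

text \<open>Resolves an estimate with Y on both sides: the right side carries Y to an exponent at
  most k - 1/2, so cancelling leaves Y^(1/2) on the left, and squaring turns N^2 into N^4.\<close>

lemma power_le_powr_imp_le:
  fixes Y N T c :: real
  assumes k: "k \<ge> 2" and Y: "Y \<ge> 1" and N: "N \<ge> 1" and T: "T \<ge> 0" and c: "c \<ge> 0"
    and le: "Y ^ k \<le> T * (c * Y ^ (k - 1) * N) powr (1 + 1 / (2 * real k))"
  shows "Y \<le> (T * c powr (1 + 1 / (2 * real k)))\<^sup>2 * N ^ 4"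
proof -
  define \<delta> where "\<delta> = 1 + 1 / (2 * real k)"
  let ?C = "T * c powr \<delta>"
  have "Y powr k = Y ^ k"
    using Y by (simp add: powr_realpow)
  also have "\<dots> \<le> T * (c powr \<delta> * (Y powr (real k - 1)) powr \<delta> * N powr \<delta>)"
    using le c Y N k
    by (simp add: powr_mult \<delta>_def of_nat_diff flip: powr_realpow)
  also have "\<dots> = ?C * Y powr ((real k - 1) * \<delta>) * N powr \<delta>"
    by (simp add: powr_powr)
  also have "\<dots> \<le> ?C * Y powr (real k - 1 / 2) * N powr 2"
  \<comment> \<open>\<open>\<delta>\<close> is chosen so that the exponent \<open>(k - 1) * \<delta>\<close> stays a fixed amount below \<open>k\<close>.\<close>
  proof (intro mult_mono[OF mult_left_mono] powr_mono)
    show "(real k - 1) * \<delta> \<le> real k - 1 / 2" "\<delta> \<le> 2"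
      using k by (auto simp: \<delta>_def field_simps)
  qed (use Y N T in auto)
  finally have "Y powr (1 / 2) * Y powr (real k - 1 / 2) \<le> ?C * N\<^sup>2 * Y powr (real k - 1 / 2)"
    using N by (simp add: mult_ac flip: powr_add)
  then have "Y powr (1 / 2) \<le> ?C * N\<^sup>2"
    using Y by simp
  then have "(Y powr (1 / 2))\<^sup>2 \<le> (?C * N\<^sup>2)\<^sup>2"
    by (rule power_mono) simp
  then show ?thesis
    using Y by (simp add: power_mult_distrib powr_half_sqrt \<delta>_def)
qed

text \<open>The conjecture requires coprime terms, so it is applied after division by the gcd.
  Passing to the quotients does not increase the radicals, and the gcd returns as a factor.\<close>

lemma abc_imp_coprime_bound:
  assumes "abc_conjecture" "\<epsilon> > 0"
  obtains K :: real where "K > 0"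
    and "\<And>P Q :: int. P \<noteq> 0 \<Longrightarrow> Q \<noteq> 0 \<Longrightarrow> P + Q \<noteq> 0 \<Longrightarrow>
      real_of_int \<bar>P\<bar> \<le> real_of_int \<bar>gcd P Q\<bar> * (K * real_of_int (int_radical P * int_radical Q * int_radical (P + Q)) powr (1 + \<epsilon>))"
proof -
  from assms obtain K0 :: real where K0: "\<And>A B C :: int. A \<noteq> 0 \<Longrightarrow> B \<noteq> 0 \<Longrightarrow> C \<noteq> 0 \<Longrightarrow>
      coprime A B \<Longrightarrow> coprime A C \<Longrightarrow> coprime B C \<Longrightarrow> A + B = C \<Longrightarrow>
      real_of_int (Max {\<bar>A\<bar>, \<bar>B\<bar>, \<bar>C\<bar>}) < K0 * real_of_int (int_radical (A * B * C)) powr (1 + \<epsilon>)"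
    unfolding abc_conjecture_def by blast
  show thesis
  \<comment> \<open>The maximum with 1 is positive without any argument about the sign of
    \<open>K0\<close>.\<close>
  proof (rule that[of "max 1 K0"])
    fix P Q :: int
    assume nz: "P \<noteq> 0" "Q \<noteq> 0" "P + Q \<noteq> 0"
    define D where "D = gcd P Q"
    have D: "D > 0"
      using nz by (simp add: D_def)
    obtain A B where AB: "P = A * D" "Q = B * D" "coprime A B"
      using gcd_coprime_exists[of P Q, folded D_def] D by blast
    then have PQ: "P + Q = (A + B) * D"
      by (simp add: algebra_simps)
    have nzAB: "A \<noteq> 0" "B \<noteq> 0" "A + B \<noteq> 0"
      using nz AB PQ by auto
    have cop: "coprime A (A + B)" "coprime B (A + B)"
      using AB(3) by (simp_all add: coprime_iff_gcd_eq_1 gcd.commute[of B "A + B"])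
    let ?N = "int_radical P * int_radical Q * int_radical (P + Q)"
    have "int_radical (A * B * (A + B)) \<le> int_radical A * int_radical B * int_radical (A + B)"
      using int_radical_mult_le[of "A * B" "A + B"] int_radical_mult_le[of A B] nzAB
        int_radical_pos[of "A + B"]
      by (meson mult_right_mono mult_eq_0_iff order_trans less_imp_le)
    also have "\<dots> \<le> ?N"
      using nz AB PQ
      by (intro mult_mono int_radical_dvd_mono)
        (auto intro!: mult_nonneg_nonneg less_imp_le[OF int_radical_pos])
    finally have N: "int_radical (A * B * (A + B)) \<le> ?N" .
    have "real_of_int \<bar>A\<bar> \<le> real_of_int (Max {\<bar>A\<bar>, \<bar>B\<bar>, \<bar>A + B\<bar>})"
      by (subst of_int_le_iff, rule Max_ge) auto
    also have "\<dots> \<le> K0 * int_radical (A * B * (A + B)) powr (1 + \<epsilon>)"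
      using K0[OF nzAB AB(3) cop refl] by simp
    also have "\<dots> \<le> max 1 K0 * real_of_int ?N powr (1 + \<epsilon>)"
    proof (intro mult_mono powr_mono2)
      show "real_of_int (int_radical (A * B * (A + B))) \<le> real_of_int ?N"
        using N by (simp only: of_int_le_iff)
    qed (use assms int_radical_pos[of "A * B * (A + B)"] in auto)
    finally have "real_of_int D * real_of_int \<bar>A\<bar>
        \<le> real_of_int D * (max 1 K0 * real_of_int ?N powr (1 + \<epsilon>))"
      using D by (intro mult_left_mono) auto
    moreover have "real_of_int \<bar>P\<bar> = real_of_int D * real_of_int \<bar>A\<bar>"
      using D by (simp add: AB(1) abs_mult)
    moreover have "real_of_int \<bar>gcd P Q\<bar> = real_of_int D"
      by (simp add: D_def)
    ultimately show "real_of_int \<bar>P\<bar> \<le> real_of_int \<bar>gcd P Q\<bar> * (max 1 K0 * real_of_int ?N powr (1 + \<epsilon>))"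
      by (simp only:)
  qed simp
qed

text \<open>The missing coefficient is decisive: it makes the radicals of the two summands together
  O(|y|^(k - 1)), one power short of the size |y|^k of the leading term.\<close>

lemma abc_radical_lower_bound:
  fixes h :: "int poly"
  assumes abc: "abc_conjecture"
    and deg: "degree h \<ge> 2" and gap: "coeff h (degree h - 1) = 0"
    and not_monom: "\<And>c k. h \<noteq> monom c k"
  obtains L :: real where "L \<ge> 0"
    and "\<And>y. poly h y \<noteq> 0 \<Longrightarrow> \<bar>real_of_int y\<bar> \<le> L * real_of_int (int_radical (poly h y)) ^ 4"
proof -
  define d where "d = degree h"
  define a where "a = lead_coeff h"
  define R where "R = h - monom a d"
  have a: "a \<noteq> 0"
    using deg by (auto simp: a_def)
  have "R \<noteq> 0"
    using not_monom by (auto simp: R_def)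
  have degR: "degree R \<le> d - 2"
  proof (rule degree_le, safe)
    fix i assume "d - 2 < i"
    then consider "i = d - 1" | "i = d" | "i > d" by linarith
    then show "coeff R i = 0"
      using gap deg by cases (auto simp: R_def d_def a_def coeff_eq_0)
  qed
  \<comment> \<open>Taking out the full power of y makes S(0) nonzero, so that a S(0)^k really
    bounds the gcd. As j \<le> deg R \<le> d - 2, at least two powers of y remain in the leading
    term.\<close>
  obtain S where S: "R = [:0, 1:] ^ order 0 R * S" "\<not> [:0, 1:] dvd S"
    using order_decomp[OF \<open>R \<noteq> 0\<close>, of 0] by auto
  define j where "j = order 0 R"
  define k where "k = d - j"
  have S0: "poly S 0 \<noteq> 0"
    using S(2) poly_eq_0_iff_dvd[of S 0] by simp
  have "S \<noteq> 0"
    using S0 by auto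
  have "degree R = j + degree S"
    using \<open>S \<noteq> 0\<close> by (subst S(1)) (simp add: degree_mult_eq degree_power_eq j_def)
  with degR deg have k: "k \<ge> 2" "degree S \<le> k - 2" "d = j + k"
    by (auto simp: k_def d_def)
  have h: "poly h y = y ^ j * (a * y ^ k + poly S y)" for y
  proof -
    have "h = monom a d + [:0, 1:] ^ j * S"
      using S(1) by (simp add: R_def j_def)
    then have "poly h y = poly (monom a d + [:0, 1:] ^ j * S) y"
      by (rule arg_cong)
    then show ?thesis
      by (simp add: k(3) poly_monom poly_power power_add algebra_simps)
  qed
  define B where "B = (\<Sum>i\<le>k - 2. \<bar>coeff S i\<bar>)"
  define \<epsilon> where "\<epsilon> = 1 / (2 * real k)"
  have "\<epsilon> > 0"
    using k by (simp add: \<epsilon>_def)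
  obtain K :: real where K: "K > 0"
    "\<And>P Q :: int. P \<noteq> 0 \<Longrightarrow> Q \<noteq> 0 \<Longrightarrow> P + Q \<noteq> 0 \<Longrightarrow>
      real_of_int \<bar>P\<bar> \<le> real_of_int \<bar>gcd P Q\<bar> * (K * real_of_int (int_radical P * int_radical Q * int_radical (P + Q)) powr (1 + \<epsilon>))"
    using abc_imp_coprime_bound[OF abc \<open>\<epsilon> > 0\<close>] by metis
  define T where "T = \<bar>a * poly S 0 ^ k\<bar>"
  define C where "C = (T * K * (\<bar>a\<bar> * B) powr (1 + \<epsilon>))\<^sup>2"
  \<comment> \<open>At these y one of the summands a y^k and S(y) may vanish, and the conjecture
    gives nothing; they are finitely many because S \<noteq> 0.\<close>
  define E where "E = insert 0 {y. poly S y = 0}"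
  have "finite E"
    using \<open>S \<noteq> 0\<close> by (simp add: E_def poly_roots_finite)
  have "B \<ge> 0"
    by (simp add: B_def sum_nonneg)
  have generic: "\<bar>y\<bar> \<le> C * int_radical (poly h y) ^ 4" if y: "poly h y \<noteq> 0" "y \<notin> E" for y
  proof -
    let ?P = "a * y ^ k" and ?Q = "poly S y"
    let ?N = "int_radical (poly h y)"
    have nz: "y \<noteq> 0" "?P \<noteq> 0" "?Q \<noteq> 0" "?P + ?Q \<noteq> 0"
      using y a h[of y] by (auto simp: E_def)
    have max_y: "max 1 \<bar>y\<bar> = \<bar>y\<bar>"
      using nz by simp
    \<comment> \<open>The power y^k contributes only a single factor |y| to the radical.\<close>
    have "int_radical ?P \<le> int_radical a * int_radical (y ^ k)"
      using nz a by (intro int_radical_mult_le) auto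
    also have "\<dots> \<le> \<bar>a\<bar> * \<bar>y\<bar>"
      using int_radical_le[OF a] order_trans[OF int_radical_power_le int_radical_le[OF nz(1)]]
        int_radical_pos[of "y ^ k"]
      by (intro mult_mono) auto
    finally have P: "int_radical ?P \<le> \<bar>a\<bar> * \<bar>y\<bar>" .
    have Q: "int_radical ?Q \<le> B * \<bar>y\<bar> ^ (k - 2)"
      using order_trans[OF int_radical_le[OF nz(3)] abs_poly_le[OF k(2)]] by (simp add: B_def max_y)
    have PQ: "int_radical (?P + ?Q) \<le> ?N"
      by (rule int_radical_dvd_mono[OF y(1)]) (simp add: h)
    have "int_radical ?P * int_radical ?Q * int_radical (?P + ?Q)
        \<le> (\<bar>a\<bar> * \<bar>y\<bar>) * (B * \<bar>y\<bar> ^ (k - 2)) * ?N"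
      using P Q PQ \<open>B \<ge> 0\<close>
      by (intro mult_mono) (auto intro!: mult_nonneg_nonneg less_imp_le[OF int_radical_pos])
    also have "\<dots> = \<bar>a\<bar> * B * \<bar>y\<bar> ^ (k - 1) * ?N"
      using k(1) by (simp add: mult_ac numeral_2_eq_2 Suc_diff_Suc flip: power_Suc)
    finally have rad: "int_radical ?P * int_radical ?Q * int_radical (?P + ?Q)
        \<le> \<bar>a\<bar> * B * \<bar>y\<bar> ^ (k - 1) * ?N" .
    have "\<bar>gcd ?P ?Q\<bar> \<le> T"
      unfolding T_def using gcd_mult_power_poly_dvd[of a y k S] a S0
      by (intro dvd_imp_le_int) auto
    have "\<bar>real_of_int y\<bar> ^ k \<le> \<bar>?P\<bar>"
    proof -
      have "1 * \<bar>y\<bar> ^ k \<le> \<bar>a\<bar> * \<bar>y\<bar> ^ k"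
        using a by (intro mult_right_mono) auto
      then show ?thesis
        by (simp add: abs_mult power_abs flip: of_int_abs of_int_power of_int_mult)
    qed
    also have "\<dots> \<le> \<bar>gcd ?P ?Q\<bar> *
        (K * real_of_int (int_radical ?P * int_radical ?Q * int_radical (?P + ?Q)) powr (1 + \<epsilon>))"
      by (rule K(2)[OF nz(2-4)])
    also have "\<dots> \<le> T * (K * real_of_int (\<bar>a\<bar> * B * \<bar>y\<bar> ^ (k - 1) * ?N) powr (1 + \<epsilon>))"
    proof (intro mult_mono powr_mono2)
      show "real_of_int \<bar>gcd ?P ?Q\<bar> \<le> T"
        using \<open>\<bar>gcd ?P ?Q\<bar> \<le> T\<close> by (simp only: of_int_le_iff)
      show "real_of_int (int_radical ?P * int_radical ?Q * int_radical (?P + ?Q))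
          \<le> real_of_int (\<bar>a\<bar> * B * \<bar>y\<bar> ^ (k - 1) * ?N)"
        using rad by (simp only: of_int_le_iff)
    qed (use K(1) \<open>\<epsilon> > 0\<close> in \<open>auto simp: T_def intro!: mult_nonneg_nonneg less_imp_le[OF int_radical_pos]\<close>)
    finally have "\<bar>real_of_int y\<bar> ^ k \<le>
        (T * K) * ((\<bar>a\<bar> * B) * \<bar>real_of_int y\<bar> ^ (k - 1) * ?N) powr (1 + 1 / (2 * real k))"
      by (simp add: \<epsilon>_def mult_ac)
    then have "\<bar>real_of_int y\<bar> \<le> ((T * K) * (\<bar>a\<bar> * B) powr (1 + 1 / (2 * real k)))\<^sup>2 * real_of_int ?N ^ 4"
      using nz(1) int_radical_pos[of "poly h y"] K(1) \<open>B \<ge> 0\<close>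
      by (intro power_le_powr_imp_le[OF k(1)]) (auto simp: T_def)
    then show ?thesis
      by (simp add: C_def \<epsilon>_def)
  qed
  have "C \<ge> 0"
    by (simp add: C_def)
  show thesis
  \<comment> \<open>The sum over \<open>E\<close> dominates every exceptional |y|; since the radical
    is at least 1, it may be multiplied by the fourth power.\<close>
  proof (rule that[of "C + (\<Sum>y\<in>E. \<bar>real_of_int y\<bar>)"])
    fix y assume y: "poly h y \<noteq> 0"
    have N: "real_of_int (int_radical (poly h y)) ^ 4 \<ge> 1"
      using int_radical_pos[of "poly h y"] by (intro one_le_power) simp
    have nonneg: "(\<Sum>y\<in>E. \<bar>real_of_int y\<bar>) \<ge> 0"
      by (rule sum_nonneg) simp
    have "\<bar>real_of_int y\<bar> \<le> C * int_radical (poly h y) ^ 4 \<or> \<bar>real_of_int y\<bar> \<le> (\<Sum>y\<in>E. \<bar>real_of_int y\<bar>) * 1"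
      using generic[OF y] \<open>finite E\<close> by (cases "y \<in> E") (auto intro!: member_le_sum)
    moreover have "C * int_radical (poly h y) ^ 4 \<ge> 0"
      using \<open>C \<ge> 0\<close> N by simp
    moreover have "(\<Sum>y\<in>E. \<bar>real_of_int y\<bar>) * 1 \<le> (\<Sum>y\<in>E. \<bar>real_of_int y\<bar>) * int_radical (poly h y) ^ 4"
      using N nonneg by (intro mult_left_mono) simp_all
    ultimately have "\<bar>real_of_int y\<bar> \<le> C * int_radical (poly h y) ^ 4
        + (\<Sum>y\<in>E. \<bar>real_of_int y\<bar>) * int_radical (poly h y) ^ 4"
      using nonneg by linarith
    then show "\<bar>real_of_int y\<bar> \<le> (C + (\<Sum>y\<in>E. \<bar>real_of_int y\<bar>)) * real_of_int (int_radical (poly h y)) ^ 4"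
      by (simp add: distrib_right)
  qed (use \<open>C \<ge> 0\<close> in \<open>simp add: sum_nonneg\<close>)
qed

section \<open>Bounding the n_i and concluding finiteness\<close>

lemma fact_le_abs_mult_prod:
  fixes c :: int and n A :: "nat \<Rightarrow> nat"
  assumes "finite I" "c \<noteq> 0" "\<And>i. i \<in> I \<Longrightarrow> A i > 0" "i \<in> I"
  shows "fact (n i) \<le> \<bar>c * (\<Prod>i\<in>I. fact (n i) * int (A i) ^ n i)\<bar>"
proof (rule zdvd_imp_le)
  have "fact (n i) dvd fact (n i) * int (A i) ^ n i" by simp
  also have "\<dots> dvd (\<Prod>i\<in>I. fact (n i) * int (A i) ^ n i)"
    using assms by (intro dvd_prodI) auto
  finally show "fact (n i) dvd \<bar>c * (\<Prod>i\<in>I. fact (n i) * int (A i) ^ n i)\<bar>"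
    by simp
  have "(\<Prod>i\<in>I. fact (n i) * int (A i) ^ n i) \<noteq> 0"
    using assms by fastforce
  with assms show "\<bar>c * (\<Prod>i\<in>I. fact (n i) * int (A i) ^ n i)\<bar> > 0"
    by simp
qed

lemma finite_poly_preimage:
  fixes f :: "rat poly"
  assumes "degree f \<ge> 1"
  shows "finite {x :: int. v = poly f (of_int x)}"
proof -
  have "f - [:v:] \<noteq> 0"
    using assms by auto
  then have "finite {x. poly (f - [:v:]) x = 0}"
    by (rule poly_roots_finite)
  then have "finite (of_int -` {x. poly (f - [:v:]) x = 0} :: int set)"
    by (rule finite_vimageI) (simp add: inj_def)
  then show ?thesis
    by (rule finite_subset[rotated]) auto
qed

theorem theorem1p2:
  fixes f :: "rat poly" and b :: int and r :: nat and A :: "nat \<Rightarrow> nat"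
  assumes "abc_conjecture"
    and "degree f \<ge> 2"
    and "\<not> (\<exists>c k. f = monom c k)"
    and "\<exists>z w :: complex. z \<noteq> w \<and> poly (map_poly of_rat f) z = 0 \<and> poly (map_poly of_rat f) w = 0"
    and "b \<noteq> 0"
    and "r \<ge> 1"
    and "\<forall>i\<in>{1..r}. A i > 0"
  shows "finite {(n, x). n \<in> {1..r} \<rightarrow>\<^sub>E {m :: nat. m > 0} \<and>
           rat_of_int b * (\<Prod>i\<in>{1..r}. fact (n i) * rat_of_nat (A i) ^ n i)
             = poly f (rat_of_int x)}"
proof -
  obtain z w :: complex where zw: "poly (map_poly of_rat f) z = 0" "poly (map_poly of_rat f) w = 0" "z \<noteq> w"
    using assms(4) by blast
  have deg1: "degree f \<ge> 1"
    using assms(2) by simp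
  obtain e :: int and h :: "int poly" and m u :: int where eh: "e \<noteq> 0" "degree h = degree f"
    "coeff h (degree f - 1) = 0" "\<And>c k. h \<noteq> monom c k"
    "\<And>x. of_int e * poly f (of_int x) = of_int (poly h (m * x + u))"
    by (rule depressed_integer_form[OF deg1 zw]) (rule that; assumption)
  obtain L :: real where L: "L \<ge> 0"
    "\<And>y. poly h y \<noteq> 0 \<Longrightarrow> \<bar>real_of_int y\<bar> \<le> L * real_of_int (int_radical (poly h y)) ^ 4"
    using abc_radical_lower_bound[of h] eh assms(1,2) by metis
  define d where "d = degree h"
  define S where "S = (\<Sum>i\<le>d. \<bar>coeff h i\<bar>)"
  define W where "W = \<bar>e * b * (\<Prod>i\<in>{1..r}. int (A i))\<bar>"
  have "S \<ge> 0"
    by (simp add: S_def sum_nonneg)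
  \<comment> \<open>The threshold is fixed before any solution is considered. The base 256^d comes
    from ((4^t)^4)^d: fourth power of the radical, then degree \<open>d\<close>.\<close>
  obtain M where M: "\<And>n. fact n \<le> (S * ((1 + L) * W ^ 4) ^ d) * (256 ^ d) ^ n \<Longrightarrow> n < M"
    using fact_le_power_imp_bounded[of "S * ((1 + L) * W ^ 4) ^ d" "256 ^ d"] by blast
  define lhs where "lhs n = rat_of_int b * (\<Prod>i\<in>{1..r}. fact (n i) * rat_of_nat (A i) ^ n i)"
    for n :: "nat \<Rightarrow> nat"
  have bound: "n i < M" if eq: "lhs n = poly f (rat_of_int x)" and i: "i \<in> {1..r}" for n x i
  proof -
    define y where "y = m * x + u"
    define v where "v = e * b * (\<Prod>i\<in>{1..r}. fact (n i) * int (A i) ^ n i)"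
    \<comment> \<open>The largest n_i plays two roles: all primes from the factorials are at most
      \<open>t\<close>, and t! divides \<open>v\<close>.\<close>
    define t where "t = Max (n ` {1..r})"
    have "t \<in> n ` {1..r}"
      unfolding t_def using i by (intro Max_in) auto
    then obtain i0 where i0: "i0 \<in> {1..r}" "n i0 = t"
      by auto
    have le_t: "n i \<le> t" if "i \<in> {1..r}" for i
      using that by (simp add: t_def)
    have "rat_of_int (poly h y) = of_int v"
      unfolding y_def eh(5)[symmetric] eq[symmetric] lhs_def v_def by simp
    then have hy: "poly h y = v"
      by (simp only: of_int_eq_iff)
    have fact_le: "fact t \<le> \<bar>v\<bar>"
      unfolding v_def using fact_le_abs_mult_prod[of "{1..r}" "e * b" A i0 n] eh(1) assms(5,7) i0 by simp
    have "v \<noteq> 0"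
      using fact_le fact_gt_zero[of t, where ?'a = int] by linarith
    have rad: "int_radical v \<le> W * 4 ^ t"
      unfolding v_def W_def using eh(1) assms(5,7) le_t
      by (intro int_radical_factorials_le) auto
    have rad1: "W * 4 ^ t \<ge> 1"
      using rad int_radical_pos[of v] by linarith
    have "\<bar>real_of_int y\<bar> \<le> L * real_of_int (int_radical v) ^ 4"
      using L(2)[of y] hy \<open>v \<noteq> 0\<close> by simp
    also have "\<dots> \<le> L * real_of_int (W * 4 ^ t) ^ 4"
      using rad L(1) int_radical_pos[of v]
      by (intro mult_left_mono power_mono) (auto simp only: of_int_le_iff of_int_0_le_iff)
    finally have y: "\<bar>real_of_int y\<bar> \<le> L * real_of_int (W * 4 ^ t) ^ 4" .
    have one_le: "real_of_int (W * 4 ^ t) ^ 4 \<ge> 1"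
      using rad1 by (intro one_le_power) (simp only: of_int_1_le_iff)
    then have "L * real_of_int (W * 4 ^ t) ^ 4 \<ge> 0"
      using L(1) by simp
    \<comment> \<open>The 1 in \<open>1 + L\<close> pays for the cut-off in the maximum, since the
      fourth power is at least 1.\<close>
    with y one_le have "max 1 \<bar>real_of_int y\<bar> \<le> (1 + L) * real_of_int (W * 4 ^ t) ^ 4"
      by (simp only: distrib_right)
    also have "real_of_int (W * 4 ^ t) ^ 4 = real_of_int W ^ 4 * (4 ^ 4) ^ t"
      by (simp only: of_int_mult of_int_power of_int_numeral power_mult_distrib
          mult.commute[of t] flip: power_mult)
    finally have y_le: "max 1 \<bar>real_of_int y\<bar> \<le> (1 + L) * W ^ 4 * 256 ^ t"
      by (simp add: mult.assoc)
    \<comment> \<open>The estimates now close up: t! is at most polynomial in |y|, which is at most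
      exponential in \<open>t\<close>.\<close>
    have "fact t \<le> S * max 1 \<bar>y\<bar> ^ d"
      using fact_le abs_poly_le[of h d y] by (simp add: hy S_def d_def)
    then have "real_of_int (fact t) \<le> real_of_int (S * max 1 \<bar>y\<bar> ^ d)"
      by (simp only: of_int_le_iff)
    also have "\<dots> = S * max 1 \<bar>real_of_int y\<bar> ^ d"
      by (simp add: of_int_max)
    also have "\<dots> \<le> S * ((1 + L) * W ^ 4 * 256 ^ t) ^ d"
      using y_le \<open>S \<ge> 0\<close> by (intro mult_left_mono power_mono) auto
    also have "\<dots> = (S * ((1 + L) * W ^ 4) ^ d) * (256 ^ d) ^ t"
      by (simp add: power_mult_distrib mult.commute flip: power_mult)
    finally have "t < M"
      using M by simp
    with le_t[OF i] show ?thesis by simp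
  qed
  \<comment> \<open>Only finitely many tuples n lie in the box, and for each of them the nonconstant
    \<open>f\<close> takes the value \<open>lhs n\<close> at finitely many integers.\<close>
  have "finite (Sigma ({1..r} \<rightarrow>\<^sub>E {..<M}) (\<lambda>n. {x :: int. lhs n = poly f (of_int x)}))"
    using assms(2) by (intro finite_SigmaI finite_PiE finite_poly_preimage) auto
  then show ?thesis
    by (rule finite_subset[rotated]) (use bound in \<open>auto simp: PiE_iff extensional_def lhs_def\<close>)
qed

end
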